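(* For a directed tree $\mathcal{T}$ and a number $n$ of subcovers, the algorithm $\mathrm{SweepCovers}(\mathcal{T},n)$ returns all sweep-covers with $n$ subcovers from $\mathcal{T}$. If none are possible, then the algorithm returns an empty set.
   Context: All trees are rooted and directed away from the root. A sweep-cover of a tree with vertex set $\mathcal V$ is a collection $S$ of non-empty subsets of $\mathcal V$ (called subcovers) such that: (1) distinct members of $S$ are disjoint; (2) each member of $S$ contains only sibling nodes, i.e. nodes sharing a parent (the singleton of the root is allowed); (3) with $\mathcal C=\bigcup_{S_i\in S}S_i$, every node of $\mathcal V$ is in $\mathcal C$, or is an ancestor of a node of $\mathcal C$, or is a descendant of a node of $\mathcal C$; (4) no node of $\mathcal C$ is an ancestor or descendant of another node of $\mathcal C$. A linear path is a path of edges in which each edge's source node has at most one outgoing edge in the tree. For a node $v$, the lowest linear descendant $\mathcal L(v)$ is the descendant of $v$ (or $v$ itself) such that there is a linear path from $v$ to $\mathcal L(v)$ and $\mathcal L(v)$ has out-degree not equal to $1$. The induced subtree defined by a node $u$ is the subtree containing $u$ and all of the descendants and ancestors of $u$. $\Gamma_{x,m}$ is the collection of all compositions of the integer $x$ into $m$ ordered positive parts. The algorithm $\mathrm{SweepCovers}(\mathcal T,n)$ is recursive and returns a collection $\mathcal Q$, initially empty. Let $v_s$ be the root of $\mathcal T$ and let $C$ be the set of children of the last node $\mathcal L(v_s)$ of the linear path beginning at $v_s$. If $n=1$: $\mathcal Q$ consists of the collections $\{\{w\}\}$ for the nodes $w$ on the linear path from $v_s$ to $\mathcal L(v_s)$,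 together with the collection $\{C\}$. Otherwise: for each partition $H$ of $C$ into $1,2,\dots,$ or $\min\{n,|C|\}$ parts, let $L$ be the collection of all singletons in $H$ and $R$ the collection of all non-singletons in $H$. If $|L|=0$ and $|R|=n$, add $R$ to $\mathcal Q$. Otherwise, for each composition $X=(X_1,\dots,X_{|L|})\in\Gamma_{n-|R|,|L|}$, form all combinations of one element of $\mathrm{SweepCovers}(\mathcal T_{L_k},X_k)$ for each $k=1,\dots,|L|$, together with $R$, where $\mathcal T_{L_k}$ is the induced subtree defined by $L_k\in L$; add to $\mathcal Q$ every resulting collection $S$ of subcovers with $|S|=n$. Finally return $\mathcal Q$.
   Formalization: The algorithm is corrected in two places: for n = 1 the collection {C} is added only when C is non-empty, and the recursion runs on the subtree of L_k and its descendants, without its ancestors; as printed it also returns collections that are not sweep-covers. *)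

theory Defs
  imports "Graph_Theory.Graph_Theory" "HOL-Library.Disjoint_Sets"
begin

section \<open>Directed trees\<close>

text \<open>
  Uniqueness of the walk (not merely of the path) from the root rules out cycles, parallel arcs
  and arcs into the root.  Trees are finite and, having a root, non-empty.
\<close>

definition rooted_tree_at :: "('a, 'b) pre_digraph \<Rightarrow> 'a \<Rightarrow> bool" where
  "rooted_tree_at T r \<longleftrightarrow> fin_digraph T \<and> r \<in> verts T \<and>
     (\<forall>v \<in> verts T. \<exists>!p. pre_digraph.awalk T r p v)"

definition directed_tree :: "('a, 'b) pre_digraph \<Rightarrow> bool" where
  "directed_tree T \<longleftrightarrow> (\<exists>r. rooted_tree_at T r)"

definition tree_root :: "('a, 'b) pre_digraph \<Rightarrow> 'a" where
  "tree_root T = (THE r. rooted_tree_at T r)"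

definition children :: "('a, 'b) pre_digraph \<Rightarrow> 'a \<Rightarrow> 'a set" where
  "children T v = {w. v \<rightarrow>\<^bsub>T\<^esub> w}"

abbreviation proper_ancestor :: "('a, 'b) pre_digraph \<Rightarrow> 'a \<Rightarrow> 'a \<Rightarrow> bool" where
  "proper_ancestor T u v \<equiv> u \<rightarrow>\<^sup>+\<^bsub>T\<^esub> v"

definition siblings :: "('a, 'b) pre_digraph \<Rightarrow> 'a set \<Rightarrow> bool" where
  "siblings T A \<longleftrightarrow> A = {tree_root T} \<or> (\<exists>p \<in> verts T. A \<subseteq> children T p)"

definition sweep_cover :: "('a, 'b) pre_digraph \<Rightarrow> 'a set set \<Rightarrow> bool" where
  "sweep_cover T S \<longleftrightarrow>
     (\<forall>A \<in> S. A \<noteq> {} \<and> A \<subseteq> verts T) \<and>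
     disjoint S \<and>
     (\<forall>A \<in> S. siblings T A) \<and>
     (\<forall>v \<in> verts T. v \<in> \<Union>S \<or> (\<exists>c \<in> \<Union>S. proper_ancestor T v c) \<or>
        (\<exists>c \<in> \<Union>S. proper_ancestor T c v)) \<and>
     (\<forall>c \<in> \<Union>S. \<forall>d \<in> \<Union>S. \<not> proper_ancestor T c d)"

section \<open>Ingredients of the algorithm\<close>

definition linear_path :: "('a, 'b) pre_digraph \<Rightarrow> 'a \<Rightarrow> 'b list \<Rightarrow> 'a \<Rightarrow> bool" where
  "linear_path T u p v \<longleftrightarrow>
     pre_digraph.apath T u p v \<and> (\<forall>e \<in> set p. out_degree T (tail T e) \<le> 1)"

definition lowest_linear_descendant :: "('a, 'b) pre_digraph \<Rightarrow> 'a \<Rightarrow> 'a" where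
  "lowest_linear_descendant T v =
     (THE u. (\<exists>p. linear_path T v p u) \<and> out_degree T u \<noteq> 1)"

definition linear_nodes :: "('a, 'b) pre_digraph \<Rightarrow> 'a \<Rightarrow> 'a set" where
  "linear_nodes T v = {w. \<exists>p. linear_path T v p (lowest_linear_descendant T v) \<and>
     w \<in> set (pre_digraph.awalk_verts T v p)}"

text \<open>
  The subtree defined by \<open>u\<close> in which the algorithm recurses is the one rooted at \<open>u\<close>: it consists
  of \<open>u\<close> and its descendants.  The paper's induced subtree also contains the proper ancestors of
  \<open>u\<close>; they must be left out here, since otherwise they lie on the linear path starting at the
  root.  For a root \<open>r\<close> with two leaves \<open>a\<close>, \<open>b\<close> and two subcovers, the algorithm would then return
  \<open>{{r}, {b}}\<close>, which is not a sweep-cover.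
\<close>

definition descendant_subtree :: "('a, 'b) pre_digraph \<Rightarrow> 'a \<Rightarrow> ('a, 'b) pre_digraph" where
  "descendant_subtree T u = T \<restriction> {w. u \<rightarrow>\<^sup>*\<^bsub>T\<^esub> w}"

definition compositions :: "nat \<Rightarrow> nat \<Rightarrow> nat list set" where
  "compositions x m = {X. length X = m \<and> (\<forall>i \<in> set X. 0 < i) \<and> sum_list X = x}"

text \<open>
  An arbitrary but fixed enumeration of a finite set.  Since the algorithm ranges over all
  compositions, its result does not depend on the enumeration.
\<close>

definition enumeration :: "'c set \<Rightarrow> 'c list" where
  "enumeration A = (SOME xs. set xs = A \<and> distinct xs)"

lemma enumeration:
  assumes "finite A"
  shows "set (enumeration A) = A" "distinct (enumeration A)" "length (enumeration A) = card A"
proof -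
  have "set (enumeration A) = A \<and> distinct (enumeration A)"
    unfolding enumeration_def using finite_distinct_list[OF assms] by (rule someI_ex)
  then show "set (enumeration A) = A" "distinct (enumeration A)"
    "length (enumeration A) = card A"
    by (auto dest: distinct_card)
qed

lemma rooted_tree_at_unique:
  assumes "rooted_tree_at T r" "rooted_tree_at T s"
  shows "r = s"
proof -
  interpret fin_digraph T using assms(1) by (simp add: rooted_tree_at_def)
  obtain p where p: "awalk r p s" using assms by (auto simp: rooted_tree_at_def)
  obtain q where q: "awalk s q r" using assms by (auto simp: rooted_tree_at_def)
  have "awalk r (p @ q) r" using p q by (rule awalk_appendI)
  moreover have "awalk r [] r" using assms(1) by (simp add: rooted_tree_at_def awalk_Nil_iff)
  ultimately have "p @ q = []" using assms(1) unfolding rooted_tree_at_def by blast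
  then show ?thesis using p by (simp add: awalk_Nil_iff)
qed

lemma tree_root_eq: "rooted_tree_at T r \<Longrightarrow> tree_root T = r"
  unfolding tree_root_def by (blast intro: the_equality rooted_tree_at_unique)

lemma root_not_below_child:
  assumes "rooted_tree_at T r" "v \<rightarrow>\<^bsub>T\<^esub> a"
  shows "\<not> a \<rightarrow>\<^sup>*\<^bsub>T\<^esub> r"
proof
  assume "a \<rightarrow>\<^sup>*\<^bsub>T\<^esub> r"
  interpret fin_digraph T using assms(1) by (simp add: rooted_tree_at_def)
  obtain q where q: "awalk a q r" using \<open>a \<rightarrow>\<^sup>*\<^bsub>T\<^esub> r\<close> by (auto simp: reachable_awalk)
  obtain e where e: "e \<in> arcs T" "tail T e = v" "head T e = a" using assms(2) by auto
  then have "v \<in> verts T" by auto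
  then obtain p where p: "awalk r p v" using assms by (auto simp: rooted_tree_at_def)
  have "awalk v (e # q) r" using e q by (simp add: awalk_Cons_iff)
  with p have "awalk r (p @ e # q) r" by (rule awalk_appendI)
  moreover have "awalk r [] r" using assms(1) by (simp add: rooted_tree_at_def awalk_Nil_iff)
  ultimately have "p @ e # q = []" using assms(1) unfolding rooted_tree_at_def by blast
  then show False by simp
qed

lemma card_descendant_subtree_less:
  assumes "directed_tree T" "a \<in> children T v"
  shows "card (verts (descendant_subtree T a)) < card (verts T)"
proof -
  obtain r where r: "rooted_tree_at T r" using assms by (auto simp: directed_tree_def)
  interpret fin_digraph T using r by (simp add: rooted_tree_at_def)
  have "\<not> a \<rightarrow>\<^sup>*\<^bsub>T\<^esub> r" using root_not_below_child[OF r] assms(2) by (simp add: children_def)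
  moreover have "{w. a \<rightarrow>\<^sup>*\<^bsub>T\<^esub> w} \<subseteq> verts T" by (auto elim: reachable_in_vertsE)
  moreover have "r \<in> verts T" using r by (simp add: rooted_tree_at_def)
  ultimately have "{w. a \<rightarrow>\<^sup>*\<^bsub>T\<^esub> w} \<subset> verts T" by blast
  then show ?thesis by (simp add: descendant_subtree_def psubset_card_mono)
qed

section \<open>The algorithm\<close>

text \<open>
  The collection \<open>{C}\<close> is a collection of subcovers only if \<open>C\<close> is non-empty, so it is
  contributed only in that case.  The test for \<open>directed_tree\<close> serves to make the recursion
  well-founded; every recursive call satisfies it when \<open>T\<close> does.
\<close>

function sweep_covers :: "('a, 'b) pre_digraph \<Rightarrow> nat \<Rightarrow> 'a set set set" where
  "sweep_covers T n =
    (if \<not> directed_tree T then {} else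
     let v = tree_root T;
         C = children T (lowest_linear_descendant T v)
     in if n = 1 then {{{w}} | w. w \<in> linear_nodes T v} \<union> (if C = {} then {} else {{C}})
        else (\<Union>H \<in> {H. partition_on C H \<and> 1 \<le> card H \<and> card H \<le> min n (card C)}.
          let L = {A \<in> H. card A = 1};
              R = {A \<in> H. card A \<noteq> 1}
          in if card L = 0 \<and> card R = n then {R}
             else (\<Union>X \<in> compositions (n - card R) (card L).
               {S. card S = n \<and>
                   (\<exists>F. (\<forall>k \<in> {..<card L}.
                          F k \<in> sweep_covers (descendant_subtree T (the_elem (enumeration L ! k))) (X ! k)) \<and>
                        S = (\<Union>k \<in> {..<card L}. F k) \<union> R)})))"
  by pat_completeness auto

termination
proof (relation "measure (\<lambda>(T, n). card (verts T))", simp, goal_cases)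
  case (1 T n v C H L R X S F k)
  then have tree: "directed_tree T" and H: "partition_on C H" "1 \<le> card H"
    and L: "L = {A \<in> H. card A = 1}" and k: "k < card L"
    and C: "C = children T (lowest_linear_descendant T v)"
    by auto
  have "finite H" using H(2) by (intro card_ge_0_finite) simp
  then have "finite L" by (simp add: L)
  then have "enumeration L ! k \<in> L" using k enumeration[of L] by (metis nth_mem)
  then obtain a where a: "enumeration L ! k = {a}" "{a} \<in> H" by (auto simp: L card_1_singleton_iff)
  then have "a \<in> C" using H(1) by (auto simp: partition_on_def)
  then show ?case using card_descendant_subtree_less[OF tree] a C by simp
qed

declare sweep_covers.simps [simp del]

end

theory Submission
  imports Defs
begin

text \<open>
  Let \<open>l\<close> be the end of the linear path from the root and \<open>C\<close> the set of its children.  Every node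
  lies on that path, where it is comparable with all nodes, or below a unique element of \<open>C\<close>.  A
  sweep-cover meeting the path is therefore a single singleton, and one that avoids it splits:
  its non-singleton subsets of \<open>C\<close> form a family \<open>R\<close>, every other member lies below exactly one
  \<open>a \<in> C - \<Union>R\<close>, and the members below \<open>a\<close> form a sweep-cover of the subtree rooted at \<open>a\<close>.
  Conversely, sweep-covers of these subtrees together with \<open>R\<close> make up a sweep-cover.  The families
  \<open>R\<close> correspond to the partitions of \<open>C\<close> and the distributions of the number of subcovers over
  \<open>C - \<Union>R\<close> to the compositions, so the algorithm is correct by induction on the number of nodes.
\<close>

section \<open>Rooted trees\<close>

locale rooted_tree =
  fixes T :: "('a, 'b) pre_digraph" and r :: 'a
  assumes rooted: "rooted_tree_at T r"

sublocale rooted_tree \<subseteq> fin_digraph T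
  using rooted by (simp add: rooted_tree_at_def)

context rooted_tree
begin

lemma root_in_verts: "r \<in> verts T"
  using rooted by (simp add: rooted_tree_at_def)

lemma awalk_unique: "awalk r p v \<Longrightarrow> awalk r q v \<Longrightarrow> p = q"
  using rooted awalk_last_in_verts unfolding rooted_tree_at_def by blast

lemma root_reachable: "v \<in> verts T \<Longrightarrow> r \<rightarrow>\<^sup>*\<^bsub>T\<^esub> v"
  using rooted unfolding rooted_tree_at_def reachable_awalk by blast

lemma tree_root: "tree_root T = r"
  using rooted by (rule tree_root_eq)

lemma directed_tree: "directed_tree T"
  using rooted by (auto simp: directed_tree_def)

text \<open>A closed walk at \<open>v\<close> could be appended to the walk from the root to
  \<open>v\<close>, giving a second walk with the same ends.\<close>

lemma reachable1_irrefl: "\<not> v \<rightarrow>\<^sup>+\<^bsub>T\<^esub> v"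
proof
  assume "v \<rightarrow>\<^sup>+\<^bsub>T\<^esub> v"
  then obtain q where q: "awalk v q v" "q \<noteq> []" by (auto simp: reachable1_awalk)
  obtain p where p: "awalk r p v"
    using root_reachable[OF awalk_hd_in_verts[OF q(1)]] by (auto simp: reachable_awalk)
  have "awalk r (p @ q) v" using p q(1) by (rule awalk_appendI)
  then have "p @ q = p" using p by (rule awalk_unique)
  then show False using q(2) by simp
qed

lemma not_adj_root: "\<not> v \<rightarrow>\<^bsub>T\<^esub> r"
  using root_not_below_child[OF rooted] root_in_verts by blast

text \<open>Each of the two arcs extends a walk from the root to a walk ending at the common head.
  These walks coincide, hence so do their last arcs.\<close>

lemma unique_arc_into:
  assumes "e \<in> arcs T" "f \<in> arcs T" "head T e = head T f"
  shows "e = f"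
proof -
  obtain p q where "awalk r p (tail T e)" "awalk r q (tail T f)"
    using root_reachable assms(1,2) by (meson reachable_awalk tail_in_verts)
  then have "awalk r (p @ [e]) (head T e)" "awalk r (q @ [f]) (head T e)"
    using assms by (auto intro!: awalk_appendI simp: awalk_simps)
  then have "p @ [e] = q @ [f]" by (rule awalk_unique)
  then show ?thesis by simp
qed

lemma unique_parent: "u \<rightarrow>\<^bsub>T\<^esub> w \<Longrightarrow> v \<rightarrow>\<^bsub>T\<^esub> w \<Longrightarrow> u = v"
  by (metis reachableE unique_arc_into)

text \<open>The last arc of a non-empty walk to \<open>w\<close> must leave the only parent of
  \<open>w\<close>, so the walk passes through \<open>v\<close>.\<close>

lemma reachable_parent:
  assumes "u \<rightarrow>\<^sup>+\<^bsub>T\<^esub> w" "v \<rightarrow>\<^bsub>T\<^esub> w"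
  shows "u \<rightarrow>\<^sup>*\<^bsub>T\<^esub> v"
  using assms by (metis reachable1_in_verts(1) reachable_conv' tranclD2 unique_parent)

text \<open>The ancestors of a node form a chain. Going down the walk from \<open>u\<close> to
  \<open>w\<close>, an ancestor of the new end is either that end or, by
  \<open>reachable_parent\<close>, an ancestor of the previous one.\<close>

lemma common_descendant_comparable:
  assumes "u \<rightarrow>\<^sup>*\<^bsub>T\<^esub> w" "v \<rightarrow>\<^sup>*\<^bsub>T\<^esub> w"
  shows "u \<rightarrow>\<^sup>*\<^bsub>T\<^esub> v \<or> v \<rightarrow>\<^sup>*\<^bsub>T\<^esub> u"
  using assms
proof (induction rule: reachable_induct)
  case base
  then show ?case by simp
next
  case (step x y)
  show ?case
  proof (cases "v = y")
    case True
    then show ?thesis using step by (meson reachable_adj_trans)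
  next
    case False
    then have "v \<rightarrow>\<^sup>*\<^bsub>T\<^esub> x" using step reachable_parent by blast
    then show ?thesis using step.IH by blast
  qed
qed

lemma children_subset_verts: "children T v \<subseteq> verts T"
  by (auto simp: children_def dest: adj_in_verts)

lemma finite_children: "finite (children T v)"
  by (rule finite_subset[OF children_subset_verts finite_verts])

text \<open>Out-degree counts arcs, \<open>children\<close> collects nodes; the counts agree because
  two arcs with the same head are equal.\<close>

lemma out_degree_eq_card_children: "out_degree T v = card (children T v)"
proof -
  have "children T v = head T ` out_arcs T v"
    by (auto simp: children_def arcs_ends_conv)
  moreover have "inj_on (head T) (out_arcs T v)"
    by (rule inj_onI) (simp add: unique_arc_into)
  ultimately show ?thesis by (simp add: out_degree_def card_image)
qed

text \<open>Two ancestors of \<open>v\<close> are comparable. If one of two distinct siblings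
  reached the other, it would also reach their parent \<open>p\<close>, closing a cycle through
  \<open>p\<close>.\<close>

lemma siblings_disjoint_subtrees:
  assumes "a \<in> children T p" "b \<in> children T p" "a \<rightarrow>\<^sup>*\<^bsub>T\<^esub> v" "b \<rightarrow>\<^sup>*\<^bsub>T\<^esub> v"
  shows "a = b"
proof (rule ccontr)
  assume ne: "a \<noteq> b"
  have *: False if "x \<rightarrow>\<^sup>*\<^bsub>T\<^esub> y" "x \<noteq> y" "x \<in> children T p" "y \<in> children T p" for x y
  proof -
    have "p \<rightarrow>\<^bsub>T\<^esub> x" using that by (simp add: children_def)
    moreover have "x \<rightarrow>\<^sup>*\<^bsub>T\<^esub> p" using that reachable_parent by (auto simp: children_def)
    ultimately have "p \<rightarrow>\<^sup>+\<^bsub>T\<^esub> p" by (meson r_into_trancl' reachable1_reachable_trans)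
    then show False using reachable1_irrefl by blast
  qed
  show False
    using common_descendant_comparable[OF assms(3,4)] *[of a b] *[of b a] assms(1,2) ne by blast
qed

end

section \<open>Subtrees\<close>

context rooted_tree
begin

lemma verts_descendant_subtree: "verts (descendant_subtree T c) = {w. c \<rightarrow>\<^sup>*\<^bsub>T\<^esub> w}"
  by (simp add: descendant_subtree_def)

text \<open>Only the source of an arc has to be tested: its head is then a descendant of
  \<open>c\<close> as well.\<close>

lemma dominates_descendant_subtree_iff:
  "u \<rightarrow>\<^bsub>descendant_subtree T c\<^esub> v \<longleftrightarrow> c \<rightarrow>\<^sup>*\<^bsub>T\<^esub> u \<and> u \<rightarrow>\<^bsub>T\<^esub> v"
  by (auto simp: descendant_subtree_def arcs_ends_conv intro: reachable_adj_trans rev_image_eqI)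
     (metis (no_types, lifting) CollectI image_eqI in_arcs_imp_in_arcs_ends reachable_adj_trans)

lemma children_descendant_subtree:
  "c \<rightarrow>\<^sup>*\<^bsub>T\<^esub> u \<Longrightarrow> children (descendant_subtree T c) u = children T u"
  by (simp add: children_def dominates_descendant_subtree_iff)

lemma reachable1_descendant_subtree_iff:
  "u \<rightarrow>\<^sup>+\<^bsub>descendant_subtree T c\<^esub> v \<longleftrightarrow> c \<rightarrow>\<^sup>*\<^bsub>T\<^esub> u \<and> u \<rightarrow>\<^sup>+\<^bsub>T\<^esub> v"
proof
  show "c \<rightarrow>\<^sup>*\<^bsub>T\<^esub> u \<and> u \<rightarrow>\<^sup>+\<^bsub>T\<^esub> v" if "u \<rightarrow>\<^sup>+\<^bsub>descendant_subtree T c\<^esub> v"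
    using that by induct (auto simp: dominates_descendant_subtree_iff)
  assume "c \<rightarrow>\<^sup>*\<^bsub>T\<^esub> u \<and> u \<rightarrow>\<^sup>+\<^bsub>T\<^esub> v"
  then have "u \<rightarrow>\<^sup>+\<^bsub>T\<^esub> v" "c \<rightarrow>\<^sup>*\<^bsub>T\<^esub> u" by auto
  then show "u \<rightarrow>\<^sup>+\<^bsub>descendant_subtree T c\<^esub> v"
  proof (induct rule: trancl_induct)
    case (base y)
    then show ?case by (auto simp: dominates_descendant_subtree_iff)
  next
    case (step y z)
    then have "y \<rightarrow>\<^bsub>descendant_subtree T c\<^esub> z"
      by (metis dominates_descendant_subtree_iff reachable1_reachable reachable_trans)
    then show ?case using step by (meson trancl_into_trancl)
  qed
qed

text \<open>Walks of the subtree are walks of \<open>T\<close>. Two of them from \<open>c\<close> to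
  \<open>v\<close> become equal once the walk from \<open>r\<close> to \<open>c\<close> is put in
  front, and this prefix cancels.\<close>

lemma rooted_tree_descendant_subtree:
  assumes "c \<in> verts T"
  shows "rooted_tree (descendant_subtree T c) c"
proof -
  let ?S = "descendant_subtree T c"
  interpret S: wf_digraph ?S
    unfolding descendant_subtree_def by (rule wellformed_induce_subgraph)
  have sub: "awalk u p v" if "S.awalk u p v" for u p v
    using that
  proof (induct p arbitrary: u)
    case Nil
    then show ?case
      by (auto simp: S.awalk_Nil_iff awalk_Nil_iff verts_descendant_subtree dest: reachable_in_verts)
  next
    case (Cons e p)
    then show ?case
      using S.awalk_Cons_iff by (simp add: awalk_Cons_iff) (simp add: descendant_subtree_def)
  qed
  obtain p where p: "awalk r p c" using root_reachable[OF assms] by (auto simp: reachable_awalk)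
  have "finite (verts ?S)"
    by (rule finite_subset[OF _ finite_verts])
       (auto simp: verts_descendant_subtree dest: reachable_in_verts)
  moreover have "finite (arcs ?S)"
    by (rule finite_subset[OF _ finite_arcs]) (auto simp: descendant_subtree_def)
  ultimately have "fin_digraph ?S" by (rule S.fin_digraphI)
  moreover have "c \<in> verts ?S" using assms by (simp add: verts_descendant_subtree)
  moreover have "\<exists>!q. S.awalk c q v" if "v \<in> verts ?S" for v
  proof (rule ex_ex1I)
    have "c \<rightarrow>\<^sup>*\<^bsub>?S\<^esub> v"
    proof (cases "v = c")
      case True
      then show ?thesis using that by simp
    next
      case False
      then have "c \<rightarrow>\<^sup>+\<^bsub>?S\<^esub> v"
        using that assms by (auto simp: reachable1_descendant_subtree_iff verts_descendant_subtree)
      then show ?thesis by blast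
    qed
    then show "\<exists>q. S.awalk c q v" by (simp add: S.reachable_awalk)
    fix q q'
    assume "S.awalk c q v" "S.awalk c q' v"
    then have "awalk r (p @ q) v" "awalk r (p @ q') v"
      using p sub by (blast intro: awalk_appendI)+
    then have "p @ q = p @ q'" by (rule awalk_unique)
    then show "q = q'" by simp
  qed
  ultimately show ?thesis by unfold_locales (simp add: rooted_tree_at_def)
qed

end

section \<open>The linear path from the root\<close>

context rooted_tree
begin

text \<open>A walk that repeats a node contains a closed subwalk, and there is none. Hence
  uniqueness of walks applies directly to linear paths.\<close>

lemma apath_iff_awalk: "apath u p v \<longleftrightarrow> awalk u p v"
proof
  assume w: "awalk u p v"
  have "distinct (awalk_verts u p)"
  proof (rule ccontr)
    assume "\<not> distinct (awalk_verts u p)"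
    then obtain q w where "q \<noteq> []" "awalk w q w"
      using awalk_not_distinct_decomp[OF w] by blast
    then show False using reachable1_irrefl reachable1_awalkI by blast
  qed
  then show "apath u p v" using w by (simp add: apath_def)
qed (simp add: apath_def)

text \<open>This describes the lowest linear descendant of the root by the ancestor relation alone,
  without mentioning walks; \<open>linear_path_root_iff\<close> shows the agreement.\<close>

definition stem_end :: "'a \<Rightarrow> bool" where
  "stem_end l \<longleftrightarrow> l \<in> verts T \<and> card (children T l) \<noteq> 1 \<and> (\<forall>w. w \<rightarrow>\<^sup>+\<^bsub>T\<^esub> l \<longrightarrow> card (children T w) = 1)"

lemma only_child:
  assumes "card (children T w) = 1" "w \<rightarrow>\<^bsub>T\<^esub> y" "w \<rightarrow>\<^sup>+\<^bsub>T\<^esub> l"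
  shows "y \<rightarrow>\<^sup>*\<^bsub>T\<^esub> l"
proof -
  obtain z where z: "w \<rightarrow>\<^bsub>T\<^esub> z" "z \<rightarrow>\<^sup>*\<^bsub>T\<^esub> l"
    using assms(3) by (metis adj_in_verts(2) reachable_conv' tranclD)
  have "z \<in> children T w" "y \<in> children T w" using z assms(2) by (simp_all add: children_def)
  then have "z = y" using assms(1) by (metis card_1_singletonE singletonD)
  then show ?thesis using z by simp
qed

text \<open>Induction along the walk from the root to \<open>v\<close>. Strictly above
  \<open>l\<close>, every step leads to an only child and so stays above or at \<open>l\<close>;
  once at or below \<open>l\<close>, the walk remains below it.\<close>

lemma stem_end_comparable:
  assumes "stem_end l" "v \<in> verts T"
  shows "v \<rightarrow>\<^sup>*\<^bsub>T\<^esub> l \<or> l \<rightarrow>\<^sup>*\<^bsub>T\<^esub> v"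
  using root_reachable[OF assms(2)]
proof (induction rule: reachable_induct)
  case base
  then show ?case using assms(1) by (auto simp: stem_end_def intro: root_reachable)
next
  case (step x y)
  show ?case
  proof (cases "l \<rightarrow>\<^sup>*\<^bsub>T\<^esub> x")
    case True
    then show ?thesis using step by (meson reachable_adj_trans)
  next
    case False
    then have "x \<noteq> l" using assms(1) by (auto simp: stem_end_def)
    then have "x \<rightarrow>\<^sup>+\<^bsub>T\<^esub> l" using False step by blast
    then show ?thesis using only_child step assms(1) by (meson stem_end_def)
  qed
qed

text \<open>Two such nodes are comparable, and a proper ancestor of the other would have exactly one
  child.\<close>

lemma stem_end_unique:
  assumes "stem_end l" "stem_end m"
  shows "l = m"
  using stem_end_comparable[OF assms(1), of m] assms by (metis reachable_neq_reachable1 stem_end_def)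

text \<open>Among the nodes whose proper ancestors all have exactly one child, take one with the
  most proper ancestors. An only child of it would qualify too, with one proper ancestor
  more.\<close>

lemma stem_end_exists: "\<exists>l. stem_end l"
proof -
  let ?P = "\<lambda>v. v \<in> verts T \<and> (\<forall>w. w \<rightarrow>\<^sup>+\<^bsub>T\<^esub> v \<longrightarrow> card (children T w) = 1)"
  let ?d = "\<lambda>v. card {w. w \<rightarrow>\<^sup>+\<^bsub>T\<^esub> v}"
  have fin: "finite {w. w \<rightarrow>\<^sup>+\<^bsub>T\<^esub> v}" for v
    by (rule finite_subset[OF _ finite_verts]) (auto dest: reachable1_in_verts)
  have bound: "?d v \<le> card (verts T)" for v
    by (rule card_mono[OF finite_verts]) (auto dest: reachable1_in_verts)
  have "\<not> w \<rightarrow>\<^sup>+\<^bsub>T\<^esub> r" for w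
    using not_adj_root by (metis tranclD2)
  then have "?P r" using root_in_verts by simp
  then obtain v where v: "?P v" and max: "\<And>w. ?P w \<Longrightarrow> ?d w \<le> ?d v"
    using ex_has_greatest_nat[of ?P r ?d "Suc (card (verts T))"] bound by (metis le_imp_less_Suc)
  have "card (children T v) \<noteq> 1"
  proof
    assume one: "card (children T v) = 1"
    then obtain y where y: "v \<rightarrow>\<^bsub>T\<^esub> y" by (auto simp: children_def card_1_singleton_iff)
    have below: "w \<rightarrow>\<^sup>+\<^bsub>T\<^esub> y \<longleftrightarrow> w = v \<or> w \<rightarrow>\<^sup>+\<^bsub>T\<^esub> v" for w
      using y by (metis reachable_neq_reachable1 reachable_parent r_into_trancl' trancl_into_trancl)
    then have "?P y" using v one y by (auto dest: adj_in_verts)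
    moreover have "{w. w \<rightarrow>\<^sup>+\<^bsub>T\<^esub> y} = insert v {w. w \<rightarrow>\<^sup>+\<^bsub>T\<^esub> v}" using below by auto
    then have "?d y = Suc (?d v)" using fin reachable1_irrefl by simp
    ultimately show False using max[of y] by simp
  qed
  then show ?thesis using v by (auto simp: stem_end_def)
qed

lemma tail_reachable1:
  assumes "awalk u p v" "e \<in> set p"
  shows "tail T e \<rightarrow>\<^sup>+\<^bsub>T\<^esub> v"
proof -
  obtain q s where "p = q @ e # s" using assms(2) by (meson split_list)
  then have "awalk (tail T e) (e # s) v"
    using assms(1) by (metis awalk_Cons_iff awalk_append_iff)
  then show ?thesis by (auto intro: reachable1_awalkI)
qed

text \<open>By uniqueness, the walk from the root to \<open>v\<close> is the one through
  \<open>w\<close>. Together with \<open>tail_reachable1\<close>, this turns the arc condition of a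
  linear path from the root into a condition on the proper ancestors of its end.\<close>

lemma reachable1_is_tail:
  assumes "awalk r p v" "w \<rightarrow>\<^sup>+\<^bsub>T\<^esub> v"
  shows "w \<in> tail T ` set p"
proof -
  obtain q where q: "awalk w q v" "q \<noteq> []" using assms(2) by (auto simp: reachable1_awalk)
  obtain s where s: "awalk r s w"
    using root_reachable[OF awalk_hd_in_verts[OF q(1)]] by (auto simp: reachable_awalk)
  have "p = s @ q" using assms(1) awalk_appendI[OF s q(1)] by (rule awalk_unique)
  then show ?thesis using q by (cases q) (auto simp: awalk_Cons_iff)
qed

lemma linear_path_root_iff:
  "(\<exists>p. linear_path T r p u) \<and> out_degree T u \<noteq> 1 \<longleftrightarrow> stem_end u"
proof
  assume "(\<exists>p. linear_path T r p u) \<and> out_degree T u \<noteq> 1"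
  then obtain p where p: "awalk r p u" "\<And>e. e \<in> set p \<Longrightarrow> card (children T (tail T e)) \<le> 1"
    and u: "card (children T u) \<noteq> 1"
    by (auto simp: linear_path_def apath_iff_awalk out_degree_eq_card_children)
  have "card (children T w) = 1" if w: "w \<rightarrow>\<^sup>+\<^bsub>T\<^esub> u" for w
  proof -
    have "card (children T w) \<le> 1" using reachable1_is_tail[OF p(1) w] p(2) by auto
    \<comment> \<open>A proper ancestor has a child, which sharpens "at most one" to "exactly
      one".\<close>
    moreover have "children T w \<noteq> {}" using w by (auto simp: children_def dest: tranclD)
    then have "card (children T w) \<noteq> 0" using finite_children by simp
    ultimately show ?thesis by simp
  qed
  then show "stem_end u" using p u by (auto simp: stem_end_def)
next
  assume s: "stem_end u"
  then obtain p where "awalk r p u" using root_reachable by (auto simp: stem_end_def reachable_awalk)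
  then show "(\<exists>p. linear_path T r p u) \<and> out_degree T u \<noteq> 1"
    using s tail_reachable1
    by (auto simp: linear_path_def apath_iff_awalk out_degree_eq_card_children stem_end_def)
qed

lemma stem_end_lowest_linear_descendant: "stem_end (lowest_linear_descendant T r)"
  unfolding lowest_linear_descendant_def linear_path_root_iff
  using stem_end_exists stem_end_unique by (blast intro: theI)

text \<open>The unique walk from the root to the lowest linear descendant passes through every
  ancestor of that node.\<close>

lemma linear_nodes_root: "linear_nodes T r = {w. w \<rightarrow>\<^sup>*\<^bsub>T\<^esub> lowest_linear_descendant T r}"
proof (intro equalityI subsetI)
  fix w
  assume "w \<in> linear_nodes T r"
  then show "w \<in> {w. w \<rightarrow>\<^sup>*\<^bsub>T\<^esub> lowest_linear_descendant T r}"
    by (auto simp: linear_nodes_def linear_path_def apath_def intro: awalk_verts_reachable_to)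
next
  let ?l = "lowest_linear_descendant T r"
  fix w
  assume "w \<in> {w. w \<rightarrow>\<^sup>*\<^bsub>T\<^esub> ?l}"
  then obtain q where q: "awalk w q ?l" by (auto simp: reachable_awalk)
  obtain s where s: "awalk r s w"
    using root_reachable[OF awalk_hd_in_verts[OF q]] by (auto simp: reachable_awalk)
  obtain p where p: "linear_path T r p ?l"
    using stem_end_lowest_linear_descendant linear_path_root_iff by blast
  then have "awalk r p ?l" by (simp add: linear_path_def apath_iff_awalk)
  then have "p = s @ q" using awalk_appendI[OF s q] by (rule awalk_unique)
  then have "w \<in> set (awalk_verts r p)"
    using awalk_appendI[OF s q] s q by (auto simp: set_awalk_verts_append intro: awalk_verts_in_verts)
  then show "w \<in> linear_nodes T r" using p by (auto simp: linear_nodes_def)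
qed

end

section \<open>Sweep-covers\<close>

context rooted_tree
begin

text \<open>With reflexive reachability, the three alternatives of the covering condition merge into
  comparability and the last condition becomes the antichain property. Absence of cycles makes the
  latter equivalent to the strict form.\<close>

lemma sweep_cover_iff:
  "sweep_cover T S \<longleftrightarrow>
     (\<forall>A \<in> S. A \<noteq> {} \<and> A \<subseteq> verts T) \<and> disjoint S \<and>
     (\<forall>A \<in> S. A = {r} \<or> (\<exists>p \<in> verts T. A \<subseteq> children T p)) \<and>
     (\<forall>v \<in> verts T. \<exists>c \<in> \<Union>S. v \<rightarrow>\<^sup>*\<^bsub>T\<^esub> c \<or> c \<rightarrow>\<^sup>*\<^bsub>T\<^esub> v) \<and>
     (\<forall>c \<in> \<Union>S. \<forall>d \<in> \<Union>S. c \<rightarrow>\<^sup>*\<^bsub>T\<^esub> d \<longrightarrow> c = d)"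
proof -
  have cover: "(v \<in> U \<or> (\<exists>c \<in> U. v \<rightarrow>\<^sup>+\<^bsub>T\<^esub> c) \<or> (\<exists>c \<in> U. c \<rightarrow>\<^sup>+\<^bsub>T\<^esub> v)) \<longleftrightarrow>
      (\<exists>c \<in> U. v \<rightarrow>\<^sup>*\<^bsub>T\<^esub> c \<or> c \<rightarrow>\<^sup>*\<^bsub>T\<^esub> v)" if "v \<in> verts T" for v U
    using that reachable_refl reachable_neq_reachable1 reachable1_reachable by metis
  have anti: "\<not> c \<rightarrow>\<^sup>+\<^bsub>T\<^esub> d \<longleftrightarrow> (c \<rightarrow>\<^sup>*\<^bsub>T\<^esub> d \<longrightarrow> c = d)" for c d
    using reachable1_irrefl reachable_neq_reachable1 reachable1_reachable by metis
  show ?thesis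
    unfolding sweep_cover_def siblings_def tree_root
    by (intro conj_cong refl ball_cong cover anti)
qed

section \<open>Sweep-covers and the linear path from the root\<close>

abbreviation lowest :: 'a where
  "lowest \<equiv> lowest_linear_descendant T r"

lemma stem_comparable:
  assumes "w \<rightarrow>\<^sup>*\<^bsub>T\<^esub> lowest" "v \<in> verts T"
  shows "w \<rightarrow>\<^sup>*\<^bsub>T\<^esub> v \<or> v \<rightarrow>\<^sup>*\<^bsub>T\<^esub> w"
  using stem_end_comparable[OF stem_end_lowest_linear_descendant assms(2)]
    common_descendant_comparable assms(1) by (meson reachable_trans)

lemma below_stem:
  assumes "v \<in> verts T" "\<not> v \<rightarrow>\<^sup>*\<^bsub>T\<^esub> lowest"
  obtains a where "a \<in> children T lowest" "a \<rightarrow>\<^sup>*\<^bsub>T\<^esub> v"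
proof -
  have "lowest \<rightarrow>\<^sup>*\<^bsub>T\<^esub> v"
    using assms stem_end_comparable[OF stem_end_lowest_linear_descendant] by blast
  moreover have "v \<noteq> lowest" using assms by auto
  ultimately have "lowest \<rightarrow>\<^sup>+\<^bsub>T\<^esub> v" by blast
  then obtain a where "lowest \<rightarrow>\<^bsub>T\<^esub> a" "a \<rightarrow>\<^sup>*\<^bsub>T\<^esub> v"
    by (metis adj_in_verts(2) reachable_conv' tranclD)
  then show thesis using that by (simp add: children_def)
qed

lemma lowest_in_verts: "lowest \<in> verts T"
  using stem_end_lowest_linear_descendant by (simp add: stem_end_def)

text \<open>A node of the linear path is comparable with every node, so the antichain property
  leaves room for nothing else.\<close>

lemma sweep_cover_meets_stem:
  assumes S: "sweep_cover T S" and w: "w \<in> \<Union>S" "w \<rightarrow>\<^sup>*\<^bsub>T\<^esub> lowest"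
  shows "S = {{w}}"
proof -
  have "c = w" if "c \<in> \<Union>S" for c
    using that w stem_comparable[OF w(2), of c] S unfolding sweep_cover_iff by blast
  moreover have "A \<noteq> {}" if "A \<in> S" for A using that S by (simp add: sweep_cover_iff)
  ultimately have "A = {w}" if "A \<in> S" for A using that by blast
  then show ?thesis using w(1) by blast
qed

text \<open>This is the case \<open>n = 1\<close> of the algorithm. The essential point is that a
  single sibling set avoiding the linear path must have \<open>lowest\<close> as its parent, since
  otherwise it lies below one child of \<open>lowest\<close> and misses the other children.\<close>

lemma sweep_cover_singleton_iff:
  "sweep_cover T {A} \<longleftrightarrow>
     A \<in> (\<lambda>w. {w}) ` linear_nodes T r \<or> A = children T lowest \<and> children T lowest \<noteq> {}"
proof
  assume S: "sweep_cover T {A}"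
  show "A \<in> (\<lambda>w. {w}) ` linear_nodes T r \<or> A = children T lowest \<and> children T lowest \<noteq> {}"
  proof (cases "\<exists>w \<in> A. w \<rightarrow>\<^sup>*\<^bsub>T\<^esub> lowest")
    case True
    then show ?thesis using sweep_cover_meets_stem[OF S] by (auto simp: linear_nodes_root)
  next
    case False
    obtain w where w: "w \<in> A" "w \<in> verts T" using S by (auto simp: sweep_cover_iff)
    have "r \<notin> A" using False root_reachable[OF lowest_in_verts] by blast
    then obtain p where p: "A \<subseteq> children T p" "p \<in> verts T"
      using S by (auto simp: sweep_cover_iff)
    obtain b where b: "b \<in> children T lowest" "b \<rightarrow>\<^sup>*\<^bsub>T\<^esub> w"
      using below_stem w False by blast
    \<comment> \<open>\<open>lowest\<close> does not have exactly one child, so besides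
      \<open>b\<close> there is a further child \<open>a\<close>, which \<open>A\<close> has to
      cover as well.\<close>
    have "children T lowest \<noteq> {b}"
      using stem_end_lowest_linear_descendant by (auto simp: stem_end_def)
    then obtain a where a: "a \<in> children T lowest" "a \<noteq> b" using b by blast
    have cover: "\<exists>c\<in>A. v \<rightarrow>\<^sup>*\<^bsub>T\<^esub> c \<or> c \<rightarrow>\<^sup>*\<^bsub>T\<^esub> v" if "v \<in> verts T" for v
      using S that by (auto simp: sweep_cover_iff)
    have "p = lowest"
    proof (rule ccontr)
      assume ne: "p \<noteq> lowest"
      have pw: "p \<rightarrow>\<^bsub>T\<^esub> w" using p w by (auto simp: children_def)
      have "b \<noteq> w" using ne pw b unique_parent by (auto simp: children_def)
      then have bp: "b \<rightarrow>\<^sup>*\<^bsub>T\<^esub> p" using b pw reachable_parent by blast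
      \<comment> \<open>The common parent \<open>p\<close> lies below \<open>b\<close>, hence so
        does all of \<open>A\<close>; but covering \<open>a\<close> requires a node of
        \<open>A\<close> comparable with \<open>a\<close>.\<close>
      have below: "b \<rightarrow>\<^sup>*\<^bsub>T\<^esub> c" if "c \<in> A" for c
        using bp that p by (auto simp: children_def intro: reachable_adj_trans)
      obtain c where c: "c \<in> A" "a \<rightarrow>\<^sup>*\<^bsub>T\<^esub> c \<or> c \<rightarrow>\<^sup>*\<^bsub>T\<^esub> a"
        using cover[of a] a children_subset_verts by blast
      have "a \<in> verts T" using a children_subset_verts by blast
      then have "b \<rightarrow>\<^sup>*\<^bsub>T\<^esub> a \<or> a \<rightarrow>\<^sup>*\<^bsub>T\<^esub> c" using c below reachable_trans by blast
      then show False
        using a b below c siblings_disjoint_subtrees \<open>a \<in> verts T\<close> by (metis reachable_refl)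
    qed
    moreover have "v \<in> A" if v: "v \<in> children T lowest" for v
    proof -
      have vT: "v \<in> verts T" using v children_subset_verts by blast
      obtain c where c: "c \<in> A" "v \<rightarrow>\<^sup>*\<^bsub>T\<^esub> c \<or> c \<rightarrow>\<^sup>*\<^bsub>T\<^esub> v" using cover[OF vT] by blast
      have "c \<in> children T lowest" "c \<in> verts T"
        using c p \<open>p = lowest\<close> children_subset_verts by blast+
      then have "c = v" using c v vT siblings_disjoint_subtrees by (metis reachable_refl)
      then show ?thesis using c by simp
    qed
    ultimately show ?thesis using p w by blast
  qed
next
  assume "A \<in> (\<lambda>w. {w}) ` linear_nodes T r \<or> A = children T lowest \<and> children T lowest \<noteq> {}"
  then show "sweep_cover T {A}"
  proof
    assume "A \<in> (\<lambda>w. {w}) ` linear_nodes T r"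
    then obtain w where w: "A = {w}" "w \<rightarrow>\<^sup>*\<^bsub>T\<^esub> lowest" by (auto simp: linear_nodes_root)
    have wT: "w \<in> verts T" using w by (meson reachable_in_verts)
    have "w = r \<or> (\<exists>p \<in> verts T. p \<rightarrow>\<^bsub>T\<^esub> w)"
      using root_reachable[OF wT] by (metis adj_in_verts(1) reachable_neq_reachable1 tranclD2)
    then show ?thesis
      using w wT stem_comparable[OF w(2)] by (auto simp: sweep_cover_iff children_def)
  next
    assume A: "A = children T lowest \<and> children T lowest \<noteq> {}"
    then obtain a where a: "a \<in> children T lowest" by blast
    have "\<exists>c \<in> A. v \<rightarrow>\<^sup>*\<^bsub>T\<^esub> c \<or> c \<rightarrow>\<^sup>*\<^bsub>T\<^esub> v" if "v \<in> verts T" for v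
    proof (cases "v \<rightarrow>\<^sup>*\<^bsub>T\<^esub> lowest")
      case True
      then have "v \<rightarrow>\<^sup>*\<^bsub>T\<^esub> a" using a by (auto simp: children_def intro: reachable_adj_trans)
      then show ?thesis using a A by blast
    next
      case False
      then show ?thesis using that below_stem A by metis
    qed
    moreover have "c = d" if "c \<in> A" "d \<in> A" "c \<rightarrow>\<^sup>*\<^bsub>T\<^esub> d" for c d
      using that A siblings_disjoint_subtrees[of c lowest d d] children_subset_verts by auto
    ultimately show ?thesis
      using A lowest_in_verts children_subset_verts by (auto simp: sweep_cover_iff disjoint_def)
  qed
qed

section \<open>Sweep-covers of a subtree, expressed in the whole tree\<close>

lemma reachable_descendant_subtree_iff:
  assumes "a \<in> verts T"
  shows "u \<rightarrow>\<^sup>*\<^bsub>descendant_subtree T a\<^esub> v \<longleftrightarrow> a \<rightarrow>\<^sup>*\<^bsub>T\<^esub> u \<and> u \<rightarrow>\<^sup>*\<^bsub>T\<^esub> v"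
proof -
  interpret S: rooted_tree "descendant_subtree T a" a
    using assms by (rule rooted_tree_descendant_subtree)
  show ?thesis
  proof (cases "u = v")
    case True
    then show ?thesis
      using S.reachable_in_verts[of u v] reachable_in_verts[of a u]
      by (auto simp: verts_descendant_subtree)
  next
    case False
    then have "u \<rightarrow>\<^sup>*\<^bsub>descendant_subtree T a\<^esub> v \<longleftrightarrow> u \<rightarrow>\<^sup>+\<^bsub>descendant_subtree T a\<^esub> v"
      "u \<rightarrow>\<^sup>*\<^bsub>T\<^esub> v \<longleftrightarrow> u \<rightarrow>\<^sup>+\<^bsub>T\<^esub> v"
      by blast+
    then show ?thesis by (simp add: reachable1_descendant_subtree_iff)
  qed
qed

lemma sweep_cover_descendant_subtree_iff:
  assumes "a \<in> verts T"
  shows "sweep_cover (descendant_subtree T a) S \<longleftrightarrow>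
     (\<forall>A \<in> S. A \<noteq> {} \<and> A \<subseteq> {w. a \<rightarrow>\<^sup>*\<^bsub>T\<^esub> w}) \<and> disjoint S \<and>
     (\<forall>A \<in> S. A = {a} \<or> (\<exists>p. a \<rightarrow>\<^sup>*\<^bsub>T\<^esub> p \<and> A \<subseteq> children T p)) \<and>
     (\<forall>v. a \<rightarrow>\<^sup>*\<^bsub>T\<^esub> v \<longrightarrow> (\<exists>c \<in> \<Union>S. v \<rightarrow>\<^sup>*\<^bsub>T\<^esub> c \<or> c \<rightarrow>\<^sup>*\<^bsub>T\<^esub> v)) \<and>
     (\<forall>c \<in> \<Union>S. \<forall>d \<in> \<Union>S. c \<rightarrow>\<^sup>*\<^bsub>T\<^esub> d \<longrightarrow> c = d)"
proof -
  interpret S: rooted_tree "descendant_subtree T a" a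
    using assms by (rule rooted_tree_descendant_subtree)
  show ?thesis
  proof (cases "\<forall>A \<in> S. A \<noteq> {} \<and> A \<subseteq> {w. a \<rightarrow>\<^sup>*\<^bsub>T\<^esub> w}")
    case True
    then have below: "a \<rightarrow>\<^sup>*\<^bsub>T\<^esub> c" if "c \<in> \<Union>S" for c using that by blast
    have "(\<forall>A \<in> S. A = {a} \<or> (\<exists>p \<in> {w. a \<rightarrow>\<^sup>*\<^bsub>T\<^esub> w}. A \<subseteq> children (descendant_subtree T a) p)) \<longleftrightarrow>
        (\<forall>A \<in> S. A = {a} \<or> (\<exists>p. a \<rightarrow>\<^sup>*\<^bsub>T\<^esub> p \<and> A \<subseteq> children T p))"
      using children_descendant_subtree by auto
    moreover have "(\<exists>c \<in> \<Union>S. (a \<rightarrow>\<^sup>*\<^bsub>T\<^esub> v \<and> v \<rightarrow>\<^sup>*\<^bsub>T\<^esub> c) \<or> (a \<rightarrow>\<^sup>*\<^bsub>T\<^esub> c \<and> c \<rightarrow>\<^sup>*\<^bsub>T\<^esub> v)) \<longleftrightarrow>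
        (\<exists>c \<in> \<Union>S. v \<rightarrow>\<^sup>*\<^bsub>T\<^esub> c \<or> c \<rightarrow>\<^sup>*\<^bsub>T\<^esub> v)" if "a \<rightarrow>\<^sup>*\<^bsub>T\<^esub> v" for v
      using below that by blast
    moreover have "(\<forall>c \<in> \<Union>S. \<forall>d \<in> \<Union>S. a \<rightarrow>\<^sup>*\<^bsub>T\<^esub> c \<and> c \<rightarrow>\<^sup>*\<^bsub>T\<^esub> d \<longrightarrow> c = d) \<longleftrightarrow>
        (\<forall>c \<in> \<Union>S. \<forall>d \<in> \<Union>S. c \<rightarrow>\<^sup>*\<^bsub>T\<^esub> d \<longrightarrow> c = d)"
      using below by blast
    ultimately show ?thesis
      unfolding S.sweep_cover_iff verts_descendant_subtree reachable_descendant_subtree_iff[OF assms]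
      by (simp only: mem_Collect_eq Ball_def[of "Collect _"] cong: imp_cong)
  next
    case False
    then show ?thesis unfolding S.sweep_cover_iff verts_descendant_subtree by blast
  qed
qed

lemma children_reachable_iff:
  assumes "a \<in> children T p" "b \<in> children T p"
  shows "a \<rightarrow>\<^sup>*\<^bsub>T\<^esub> b \<longleftrightarrow> a = b"
  using siblings_disjoint_subtrees[OF assms, of b] assms children_subset_verts by auto

section \<open>Gluing sweep-covers of the subtrees below the linear path\<close>

context
  fixes R :: "'a set set" and G :: "'a \<Rightarrow> 'a set set"
  assumes R: "\<Union>R \<subseteq> children T lowest" "disjoint R" "{} \<notin> R"
    and C: "children T lowest \<noteq> {}"
    and G: "\<And>a. a \<in> children T lowest - \<Union>R \<Longrightarrow> sweep_cover (descendant_subtree T a) (G a)"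
begin

lemma cover_below:
  assumes "a \<in> children T lowest - \<Union>R"
  shows "A \<in> G a \<Longrightarrow> A \<noteq> {}" "A \<in> G a \<Longrightarrow> A \<subseteq> {w. a \<rightarrow>\<^sup>*\<^bsub>T\<^esub> w}" "disjoint (G a)"
     "A \<in> G a \<Longrightarrow> A = {a} \<or> (\<exists>p. a \<rightarrow>\<^sup>*\<^bsub>T\<^esub> p \<and> A \<subseteq> children T p)"
     "a \<rightarrow>\<^sup>*\<^bsub>T\<^esub> v \<Longrightarrow> \<exists>c \<in> \<Union>(G a). v \<rightarrow>\<^sup>*\<^bsub>T\<^esub> c \<or> c \<rightarrow>\<^sup>*\<^bsub>T\<^esub> v"
     "c \<in> \<Union>(G a) \<Longrightarrow> d \<in> \<Union>(G a) \<Longrightarrow> c \<rightarrow>\<^sup>*\<^bsub>T\<^esub> d \<Longrightarrow> c = d"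
proof -
  have "a \<in> verts T" using assms children_subset_verts by blast
  note * = G[OF assms, unfolded sweep_cover_descendant_subtree_iff[OF this]]
  show "A \<in> G a \<Longrightarrow> A \<noteq> {}" "A \<in> G a \<Longrightarrow> A \<subseteq> {w. a \<rightarrow>\<^sup>*\<^bsub>T\<^esub> w}" "disjoint (G a)"
     "A \<in> G a \<Longrightarrow> A = {a} \<or> (\<exists>p. a \<rightarrow>\<^sup>*\<^bsub>T\<^esub> p \<and> A \<subseteq> children T p)"
     "a \<rightarrow>\<^sup>*\<^bsub>T\<^esub> v \<Longrightarrow> \<exists>c \<in> \<Union>(G a). v \<rightarrow>\<^sup>*\<^bsub>T\<^esub> c \<or> c \<rightarrow>\<^sup>*\<^bsub>T\<^esub> v"
     "c \<in> \<Union>(G a) \<Longrightarrow> d \<in> \<Union>(G a) \<Longrightarrow> c \<rightarrow>\<^sup>*\<^bsub>T\<^esub> d \<Longrightarrow> c = d"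
    using * by blast+
qed

lemma compose_member:
  assumes "A \<in> (\<Union>a \<in> children T lowest - \<Union>R. G a) \<union> R" "x \<in> A"
  obtains a where "a \<in> children T lowest" "a \<rightarrow>\<^sup>*\<^bsub>T\<^esub> x" "a \<notin> \<Union>R" "A \<in> G a"
    | "x \<in> children T lowest" "A \<in> R" "x \<in> \<Union>R"
  using assms cover_below(2) R(1) by blast

text \<open>Both nodes lie below children of \<open>lowest\<close>, and these children are equal
  because \<open>y\<close> is below both. This serves the antichain property and, with
  \<open>x = y\<close>, disjointness.\<close>

lemma compose_comparable:
  assumes "A \<in> (\<Union>a \<in> children T lowest - \<Union>R. G a) \<union> R" "x \<in> A"
    "B \<in> (\<Union>a \<in> children T lowest - \<Union>R. G a) \<union> R" "y \<in> B" "x \<rightarrow>\<^sup>*\<^bsub>T\<^esub> y"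
  shows "(\<exists>a \<in> children T lowest - \<Union>R. A \<in> G a \<and> B \<in> G a) \<or> A \<in> R \<and> B \<in> R \<and> x = y"
proof -
  show ?thesis
    using assms(1,2)
  proof (rule compose_member)
    fix a assume a: "a \<in> children T lowest" "a \<rightarrow>\<^sup>*\<^bsub>T\<^esub> x" "a \<notin> \<Union>R" "A \<in> G a"
    then have ay: "a \<rightarrow>\<^sup>*\<^bsub>T\<^esub> y" using assms(5) reachable_trans by blast
    show ?thesis
      using assms(3,4)
    proof (rule compose_member)
      fix b assume b: "b \<in> children T lowest" "b \<rightarrow>\<^sup>*\<^bsub>T\<^esub> y" "b \<notin> \<Union>R" "B \<in> G b"
      then have "a = b" using siblings_disjoint_subtrees[of a lowest b y] a ay by simp
      then show ?thesis using a b by blast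
    next
      assume y: "y \<in> children T lowest" "B \<in> R" "y \<in> \<Union>R"
      \<comment> \<open>Comparable siblings are equal, so \<open>a\<close> would lie in
        \<open>\<Union>R\<close>: this mixed case is contradictory, and so is the symmetric one
        below.\<close>
      then have "a = y" using children_reachable_iff[of a lowest y] a ay by simp
      then show ?thesis using a y by simp
    qed
  next
    assume x: "x \<in> children T lowest" "A \<in> R" "x \<in> \<Union>R"
    show ?thesis
      using assms(3,4)
    proof (rule compose_member)
      fix b assume b: "b \<in> children T lowest" "b \<rightarrow>\<^sup>*\<^bsub>T\<^esub> y" "b \<notin> \<Union>R" "B \<in> G b"
      then have "x = b" using siblings_disjoint_subtrees[of x lowest b y] x assms(5) by simp
      then show ?thesis using b x by simp
    next
      assume y: "y \<in> children T lowest" "B \<in> R" "y \<in> \<Union>R"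
      then have "x = y" using children_reachable_iff[of x lowest y] x assms(5) by simp
      then show ?thesis using x y by simp
    qed
  qed
qed

lemma sweep_cover_compose:
  "sweep_cover T ((\<Union>a \<in> children T lowest - \<Union>R. G a) \<union> R)" (is "sweep_cover T ?S")
proof -
  have refl: "z \<rightarrow>\<^sup>*\<^bsub>T\<^esub> z" if "z \<in> children T lowest" for z
    using that children_subset_verts by auto
  have nonempty: "A \<noteq> {}" if "A \<in> ?S" for A
    using that cover_below(1) R(3) by blast
  have "x \<in> verts T" if "A \<in> ?S" "x \<in> A" for A x
    using that by (rule compose_member) (use children_subset_verts in \<open>auto dest: reachable_in_verts\<close>)
  moreover have "disjoint ?S"
  proof (rule disjointI)
    fix A B assume AB: "A \<in> ?S" "B \<in> ?S" "A \<noteq> B"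
    show "A \<inter> B = {}"
    proof (rule ccontr)
      assume "A \<inter> B \<noteq> {}"
      then obtain x where x: "x \<in> A" "x \<in> B" by blast
      \<comment> \<open>A common element is comparable with itself, so \<open>A\<close> and
        \<open>B\<close> come from the same disjoint family.\<close>
      then have "x \<rightarrow>\<^sup>*\<^bsub>T\<^esub> x" using calculation AB by simp
      then have "(\<exists>a \<in> children T lowest - \<Union>R. A \<in> G a \<and> B \<in> G a) \<or> A \<in> R \<and> B \<in> R"
        using compose_comparable[of A x B x] AB x by blast
      then show False using cover_below(3) R(2) AB(3) x disjointD by blast
    qed
  qed
  moreover have "A = {r} \<or> (\<exists>p \<in> verts T. A \<subseteq> children T p)" if "A \<in> ?S" for A
    using that
  proof
    assume "A \<in> (\<Union>a \<in> children T lowest - \<Union>R. G a)"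
    then obtain a where a: "a \<in> children T lowest - \<Union>R" "A \<in> G a" by blast
    show ?thesis
      using cover_below(4)[OF a] a(1) lowest_in_verts by (auto dest: reachable_in_verts)
  next
    assume "A \<in> R"
    then show ?thesis using R(1) lowest_in_verts by blast
  qed
  moreover have "\<exists>c \<in> \<Union>?S. v \<rightarrow>\<^sup>*\<^bsub>T\<^esub> c \<or> c \<rightarrow>\<^sup>*\<^bsub>T\<^esub> v" if v: "v \<in> verts T" for v
  proof -
    have above: "\<exists>c \<in> \<Union>?S. a \<rightarrow>\<^sup>*\<^bsub>T\<^esub> c" if a: "a \<in> children T lowest" for a
    proof (cases "a \<in> \<Union>R")
      case True
      then show ?thesis using refl[OF a] by blast
    next
      case False
      then obtain c A where c: "A \<in> G a" "c \<in> A" using cover_below(5)[of a a] a refl[OF a] by blast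
      then have "a \<rightarrow>\<^sup>*\<^bsub>T\<^esub> c" using cover_below(2) False a by blast
      then show ?thesis using c False a by blast
    qed
    show ?thesis
    proof (cases "v \<rightarrow>\<^sup>*\<^bsub>T\<^esub> lowest")
      case True
      \<comment> \<open>Nodes of the linear path are covered by what lies at or below an arbitrary
        child of \<open>lowest\<close>; this is where \<open>C\<close> enters.\<close>
      obtain a where a: "a \<in> children T lowest" using C by blast
      then have "v \<rightarrow>\<^sup>*\<^bsub>T\<^esub> a" using True by (auto simp: children_def intro: reachable_adj_trans)
      then show ?thesis using above[OF a] reachable_trans by meson
    next
      case False
      with v obtain a where a: "a \<in> children T lowest" "a \<rightarrow>\<^sup>*\<^bsub>T\<^esub> v" by (rule below_stem)
      show ?thesis
      proof (cases "a \<in> \<Union>R")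
        case True
        then show ?thesis using a by blast
      next
        case False
        then have D: "a \<in> children T lowest - \<Union>R" using a by blast
        show ?thesis using cover_below(5)[OF D a(2)] D by blast
      qed
    qed
  qed
  moreover have "c = d" if cd: "c \<in> \<Union>?S" "d \<in> \<Union>?S" "c \<rightarrow>\<^sup>*\<^bsub>T\<^esub> d" for c d
  proof -
    obtain A B where AB: "A \<in> ?S" "c \<in> A" "B \<in> ?S" "d \<in> B" using cd by blast
    show ?thesis using compose_comparable[OF AB cd(3)] cover_below(6) AB cd(3) by blast
  qed
  ultimately show ?thesis
    unfolding sweep_cover_iff using nonempty by (intro conjI ballI impI) (simp_all add: subsetI)
qed

text \<open>The families are pairwise disjoint as collections, so their sizes add. Members are
  non-empty, and an element of a shared member would lie below two children of
  \<open>lowest\<close>, or would be a child lying both inside and outside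
  \<open>\<Union>R\<close>.\<close>

lemma card_compose:
  "card ((\<Union>a \<in> children T lowest - \<Union>R. G a) \<union> R) =
    (\<Sum>a \<in> children T lowest - \<Union>R. card (G a)) + card R"
proof -
  let ?D = "children T lowest - \<Union>R"
  have fin: "finite (G a)" if "a \<in> ?D" for a
  proof (rule finite_subset)
    show "G a \<subseteq> Pow (verts T)"
      using cover_below(2)[OF that] by (blast dest: reachable_in_verts)
  qed simp
  have finR: "finite R"
    using finite_subset[OF R(1) finite_children] by (rule finite_UnionD)
  have "G a \<inter> G b = {}" if ab: "a \<in> ?D" "b \<in> ?D" "a \<noteq> b" for a b
  proof (rule ccontr)
    assume "G a \<inter> G b \<noteq> {}"
    then obtain A where A: "A \<in> G a" "A \<in> G b" by blast
    then obtain x where "x \<in> A" using cover_below(1)[OF ab(1)] by blast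
    then have "a \<rightarrow>\<^sup>*\<^bsub>T\<^esub> x" "b \<rightarrow>\<^sup>*\<^bsub>T\<^esub> x"
      using A cover_below(2)[OF ab(1)] cover_below(2)[OF ab(2)] by blast+
    then show False using siblings_disjoint_subtrees ab by blast
  qed
  then have "card (\<Union>a \<in> ?D. G a) = (\<Sum>a \<in> ?D. card (G a))"
    using fin finite_children by (intro card_UN_disjoint) auto
  moreover have "(\<Union>a \<in> ?D. G a) \<inter> R = {}"
  proof -
    have False if A: "a \<in> ?D" "A \<in> G a" "A \<in> R" for a A
    proof -
      obtain x where x: "x \<in> A" using cover_below(1)[OF A(1,2)] by blast
      then have "x \<in> children T lowest" "a \<rightarrow>\<^sup>*\<^bsub>T\<^esub> x"
        using A(3) R(1) cover_below(2)[OF A(1,2)] by blast+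
      then have "a = x" using A(1) children_reachable_iff by blast
      then show False using A x by blast
    qed
    then show ?thesis by blast
  qed
  ultimately show ?thesis
    using fin finR finite_children by (simp add: card_Un_disjoint)
qed

end

text \<open>This is the converse of gluing. A singleton \<open>{a}\<close> with \<open>a\<close> a
  child of \<open>lowest\<close> is not put into \<open>R\<close>; it belongs to \<open>G a\<close>
  as the root cover of the subtree at \<open>a\<close>.\<close>

lemma sweep_cover_decompose:
  assumes S: "sweep_cover T S" and avoids: "\<forall>w \<in> \<Union>S. \<not> w \<rightarrow>\<^sup>*\<^bsub>T\<^esub> lowest"
  defines "R \<equiv> {A \<in> S. A \<subseteq> children T lowest \<and> card A \<noteq> 1}"
    and "G \<equiv> \<lambda>a. {A \<in> S. A \<subseteq> {w. a \<rightarrow>\<^sup>*\<^bsub>T\<^esub> w}}"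
  shows "children T lowest \<noteq> {}" "\<Union>R \<subseteq> children T lowest" "disjoint R" "{} \<notin> R"
    "\<And>a. a \<in> children T lowest - \<Union>R \<Longrightarrow> sweep_cover (descendant_subtree T a) (G a)"
    "S = (\<Union>a \<in> children T lowest - \<Union>R. G a) \<union> R"
proof -
  have S': "\<And>A. A \<in> S \<Longrightarrow> A \<noteq> {}" "\<And>A. A \<in> S \<Longrightarrow> A \<subseteq> verts T" "disjoint S"
    "\<And>A. A \<in> S \<Longrightarrow> A = {r} \<or> (\<exists>p \<in> verts T. A \<subseteq> children T p)"
    "\<And>v. v \<in> verts T \<Longrightarrow> \<exists>c \<in> \<Union>S. v \<rightarrow>\<^sup>*\<^bsub>T\<^esub> c \<or> c \<rightarrow>\<^sup>*\<^bsub>T\<^esub> v"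
    "\<And>c d. c \<in> \<Union>S \<Longrightarrow> d \<in> \<Union>S \<Longrightarrow> c \<rightarrow>\<^sup>*\<^bsub>T\<^esub> d \<Longrightarrow> c = d"
    using S unfolding sweep_cover_iff by blast+
  obtain c where c: "c \<in> \<Union>S" using S'(5) root_in_verts by blast
  then have "c \<in> verts T" using S'(2) by blast
  then show C: "children T lowest \<noteq> {}" using below_stem avoids c by blast
  show "\<Union>R \<subseteq> children T lowest" "disjoint R" "{} \<notin> R"
    using S'(1,3) by (auto simp: R_def disjoint_def)
  \<comment> \<open>A member outside \<open>R\<close> that meets the subtree at \<open>a\<close>
    stays in it: either it is a singleton, or the common parent of its nodes already lies below
    \<open>a\<close>.\<close>
  have inside: "A \<subseteq> {w. a \<rightarrow>\<^sup>*\<^bsub>T\<^esub> w}"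
    if A: "A \<in> S" "A \<notin> R" and x: "x \<in> A" and a: "a \<in> children T lowest" "a \<rightarrow>\<^sup>*\<^bsub>T\<^esub> x" for A a x
  proof (cases "A \<subseteq> children T lowest")
    case True
    then have "card A = 1" using A by (simp add: R_def)
    then have "A = {x}" using x by (metis card_1_singletonE singletonD)
    then show ?thesis using a by simp
  next
    case False
    have "A \<noteq> {r}" using avoids root_reachable[OF lowest_in_verts] A(1) by blast
    then obtain p where p: "A \<subseteq> children T p" using S'(4)[OF A(1)] by blast
    have px: "p \<rightarrow>\<^bsub>T\<^esub> x" using p x by (auto simp: children_def)
    have "p \<noteq> lowest" using False p by blast
    then have "a \<noteq> x" using a px unique_parent by (auto simp: children_def)
    then have "a \<rightarrow>\<^sup>*\<^bsub>T\<^esub> p" using a px reachable_parent by blast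
    then show ?thesis using p by (auto simp: children_def intro: reachable_adj_trans)
  qed
  show "S = (\<Union>a \<in> children T lowest - \<Union>R. G a) \<union> R"
  proof (intro equalityI subsetI)
    fix A assume A: "A \<in> S"
    show "A \<in> (\<Union>a \<in> children T lowest - \<Union>R. G a) \<union> R"
    proof (cases "A \<in> R")
      case False
      obtain x where x: "x \<in> A" using S'(1) A by blast
      then obtain a where a: "a \<in> children T lowest" "a \<rightarrow>\<^sup>*\<^bsub>T\<^esub> x"
        using below_stem avoids A S'(2) by (metis UnionI subsetD)
      \<comment> \<open>A member of \<open>R\<close> containing \<open>a\<close> would contain
        \<open>x\<close> by the antichain property, hence be \<open>A\<close> by
        disjointness.\<close>
      have "a \<notin> \<Union>R"
      proof
        assume "a \<in> \<Union>R"
        then obtain B where B: "B \<in> R" "a \<in> B" by blast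
        then have "a = x" using S'(6)[of a x] a A x by (auto simp: R_def)
        then have "A = B" using disjointD[OF S'(3), of A B] B A x by (auto simp: R_def)
        then show False using B False by simp
      qed
      then show ?thesis using inside[OF A False x a] A a by (auto simp: G_def)
    qed simp
  qed (auto simp: R_def G_def)
  show "sweep_cover (descendant_subtree T a) (G a)" if a: "a \<in> children T lowest - \<Union>R" for a
  proof -
    have aT: "a \<in> verts T" using a children_subset_verts by blast
    have "A = {a} \<or> (\<exists>p. a \<rightarrow>\<^sup>*\<^bsub>T\<^esub> p \<and> A \<subseteq> children T p)" if A: "A \<in> G a" for A
    proof -
      have A': "A \<in> S" "A \<subseteq> {w. a \<rightarrow>\<^sup>*\<^bsub>T\<^esub> w}" using A by (auto simp: G_def)
      have "A \<noteq> {r}" using avoids root_reachable[OF lowest_in_verts] A' by blast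
      then obtain p where p: "A \<subseteq> children T p" using S'(4)[OF A'(1)] by blast
      obtain x where x: "x \<in> A" using S'(1) A' by blast
      have px: "p \<rightarrow>\<^bsub>T\<^esub> x" using p x by (auto simp: children_def)
      show ?thesis
      proof (cases "a = x")
        case True
        then have "p = lowest" using px a unique_parent by (auto simp: children_def)
        \<comment> \<open>Now \<open>A\<close> consists of children of \<open>lowest\<close> lying
          below \<open>a\<close>, and among siblings only \<open>a\<close> itself does.\<close>
        then have "A = {a}" using p A' a x True children_reachable_iff by blast
        then show ?thesis by simp
      next
        case False
        then have "a \<rightarrow>\<^sup>*\<^bsub>T\<^esub> p" using x A' px reachable_parent by blast
        then show ?thesis using p by blast
      qed
    qed
    moreover have "\<exists>c \<in> \<Union>(G a). v \<rightarrow>\<^sup>*\<^bsub>T\<^esub> c \<or> c \<rightarrow>\<^sup>*\<^bsub>T\<^esub> v" if v: "a \<rightarrow>\<^sup>*\<^bsub>T\<^esub> v" for v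
    proof -
      have "v \<in> verts T" using v by (rule reachable_in_verts)
      then obtain c A where c: "A \<in> S" "c \<in> A" "v \<rightarrow>\<^sup>*\<^bsub>T\<^esub> c \<or> c \<rightarrow>\<^sup>*\<^bsub>T\<^esub> v"
        using S'(5) by blast
      \<comment> \<open>Otherwise \<open>c\<close> is a proper ancestor of \<open>a\<close>,
        therefore at or above its parent \<open>lowest\<close>, which the cover avoids.\<close>
      have "a \<rightarrow>\<^sup>*\<^bsub>T\<^esub> c"
      proof (rule ccontr)
        assume n: "\<not> a \<rightarrow>\<^sup>*\<^bsub>T\<^esub> c"
        then have "c \<rightarrow>\<^sup>*\<^bsub>T\<^esub> v" using c v reachable_trans by blast
        then have ca: "c \<rightarrow>\<^sup>*\<^bsub>T\<^esub> a" "c \<noteq> a" using n v common_descendant_comparable aT by auto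
        then have "c \<rightarrow>\<^sup>*\<^bsub>T\<^esub> lowest" using a reachable_parent[of c a lowest] by (auto simp: children_def)
        then show False using avoids c by blast
      qed
      moreover have "A \<notin> R"
      proof
        assume "A \<in> R"
        then have "c \<in> children T lowest" "c \<in> \<Union>R" using c by (auto simp: R_def)
        then show False using \<open>a \<rightarrow>\<^sup>*\<^bsub>T\<^esub> c\<close> a children_reachable_iff by blast
      qed
      ultimately have "A \<in> G a" using inside c a by (auto simp: G_def)
      then show ?thesis using c by blast
    qed
    moreover have "G a \<subseteq> S" by (auto simp: G_def)
    moreover from this have "disjoint (G a)" using pairwise_subset[OF S'(3)] by blast
    ultimately show ?thesis
      unfolding sweep_cover_descendant_subtree_iff[OF aT]
      using S'(1) by (intro conjI ballI impI S'(6)) (auto simp: G_def)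
  qed
qed

end

section \<open>Correctness of the algorithm\<close>

lemma bij_betw_enumeration_singletons:
  assumes "finite D"
  shows "bij_betw (\<lambda>k. the_elem (enumeration ((\<lambda>a. {a}) ` D) ! k))
    {..<card ((\<lambda>a. {a}) ` D)} D"
proof -
  let ?L = "(\<lambda>a. {a}) ` D"
  have "finite ?L" using assms by simp
  then have "bij_betw ((!) (enumeration ?L)) {..<card ?L} ?L"
    by (intro bij_betw_nth) (simp_all only: enumeration)
  moreover have "bij_betw the_elem ?L D"
    by (rule bij_betw_imageI) (auto simp: inj_on_def image_image)
  ultimately have "bij_betw (the_elem \<circ> (!) (enumeration ?L)) {..<card ?L} D"
    by (rule bij_betw_trans)
  then show ?thesis by (simp add: comp_def)
qed

text \<open>The blocks are disjoint and exhaust \<open>C\<close>, so the points missed by the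
  non-singleton blocks are exactly those forming a block of their own. Thus \<open>R\<close>
  determines the partition.\<close>

lemma partition_on_split_singletons:
  assumes "partition_on C H"
  defines "R \<equiv> {A \<in> H. card A \<noteq> 1}"
  shows "\<Union>R \<subseteq> C" "disjoint R" "{} \<notin> R" "{A \<in> H. card A = 1} = (\<lambda>a. {a}) ` (C - \<Union>R)"
proof -
  have H: "\<Union>H = C" "disjoint H" "{} \<notin> H" using assms by (auto simp: partition_on_def)
  show "\<Union>R \<subseteq> C" "{} \<notin> R" using H by (auto simp: R_def)
  show "disjoint R" using pairwise_subset[OF H(2)] by (auto simp: R_def)
  show "{A \<in> H. card A = 1} = (\<lambda>a. {a}) ` (C - \<Union>R)"
  proof (intro equalityI subsetI)
    fix A assume A: "A \<in> {A \<in> H. card A = 1}"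
    then obtain a where a: "A = {a}" by (auto simp: card_1_singleton_iff)
    have "B = A" if "B \<in> H" "a \<in> B" for B
      using disjointD[OF H(2), of A B] A a that by auto
    then have "a \<notin> \<Union>R" using A by (auto simp: R_def)
    then show "A \<in> (\<lambda>a. {a}) ` (C - \<Union>R)" using A a H(1) by auto
  next
    fix A assume "A \<in> (\<lambda>a. {a}) ` (C - \<Union>R)"
    then obtain a where a: "A = {a}" "a \<in> C" "a \<notin> \<Union>R" by blast
    then obtain B where B: "B \<in> H" "a \<in> B" using H(1) by blast
    then have "card B = 1" using a by (auto simp: R_def)
    then have "B = A" using B a by (metis card_1_singletonE singletonD)
    then show "A \<in> {A \<in> H. card A = 1}" using B \<open>card B = 1\<close> by simp
  qed
qed

text \<open>This recovers from the family \<open>R\<close> of a given sweep-cover the partition for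
  which the algorithm finds that cover.\<close>

lemma partition_on_add_singletons:
  assumes "\<Union>R \<subseteq> C" "disjoint R" "{} \<notin> R" "\<And>A. A \<in> R \<Longrightarrow> card A \<noteq> 1"
  defines "L \<equiv> (\<lambda>a. {a}) ` (C - \<Union>R)"
  shows "partition_on C (R \<union> L)" "{A \<in> R \<union> L. card A = 1} = L" "{A \<in> R \<union> L. card A \<noteq> 1} = R"
proof -
  show "partition_on C (R \<union> L)"
    using assms(1-3) by (auto simp: partition_on_def L_def disjoint_def)
  show "{A \<in> R \<union> L. card A = 1} = L" "{A \<in> R \<union> L. card A \<noteq> 1} = R"
    using assms(4) by (auto simp: L_def)
qed

lemma card_partition_le:
  assumes "partition_on C H" "finite C"
  shows "card H \<le> card C"
proof -
  have H: "A \<noteq> {}" "finite A" if "A \<in> H" for A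
    using that assms by (auto simp: partition_on_def intro: finite_subset[of _ "\<Union>H"])
  have "card H = (\<Sum>A \<in> H. 1)" by simp
  also have "\<dots> \<le> (\<Sum>A \<in> H. card A)"
    using H by (intro sum_mono) (simp add: Suc_le_eq card_gt_0_iff)
  also have "\<dots> = card C" using product_partition[OF assms(1)] H(2) by simp
  finally show ?thesis .
qed

section \<open>The recursion step and the induction on the number of nodes\<close>

context rooted_tree
begin

text \<open>For \<open>n \<noteq> 1\<close>, soundness is \<open>sweep_cover_compose\<close> and
  completeness is \<open>sweep_cover_decompose\<close>; the remaining work is to translate between
  families indexed by nodes and by positions.\<close>

lemma sweep_covers_step:
  assumes IH: "\<And>a m. a \<in> children T lowest \<Longrightarrow>
    sweep_covers (descendant_subtree T a) m =
      {S. sweep_cover (descendant_subtree T a) S \<and> card S = m}"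
  shows "sweep_covers T n = {S. sweep_cover T S \<and> card S = n}"
proof (cases "n = 1")
  case True
  have "sweep_covers T n = {{{w}} | w. w \<in> linear_nodes T r} \<union>
      (if children T lowest = {} then {} else {{children T lowest}})"
    using True directed_tree by (simp add: sweep_covers.simps tree_root Let_def)
  also have "\<dots> = {{A} | A. sweep_cover T {A}}"
    unfolding sweep_cover_singleton_iff by auto
  also have "\<dots> = {S. sweep_cover T S \<and> card S = n}"
    using True by (auto simp: card_1_singleton_iff)
  finally show ?thesis .
next
  case False
  let ?C = "children T lowest"
  let ?f = "\<lambda>L k. the_elem (enumeration L ! k)"
  \<comment> \<open>The contribution of one partition as a function of its singletons and
    non-singletons, so that it can be evaluated once these sets are known in another form.\<close>
  let ?results = "\<lambda>L R. if card L = 0 \<and> card R = n then {R}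
    else (\<Union>X \<in> compositions (n - card R) (card L).
      {S. card S = n \<and>
        (\<exists>F. (\<forall>k \<in> {..<card L}. F k \<in> sweep_covers (descendant_subtree T (?f L k)) (X ! k)) \<and>
          S = (\<Union>k \<in> {..<card L}. F k) \<union> R)})"
  have unfold: "sweep_covers T n =
    (\<Union>H \<in> {H. partition_on ?C H \<and> 1 \<le> card H \<and> card H \<le> min n (card ?C)}.
      ?results {A \<in> H. card A = 1} {A \<in> H. card A \<noteq> 1})"
    using False directed_tree by (subst sweep_covers.simps) (simp add: tree_root Let_def)
  have finC: "finite ?C" by (rule finite_children)
  show ?thesis
  proof (intro equalityI subsetI)
    fix S assume "S \<in> sweep_covers T n"
    then obtain H where H: "partition_on ?C H" "1 \<le> card H" "card H \<le> min n (card ?C)"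
      and S: "S \<in> ?results {A \<in> H. card A = 1} {A \<in> H. card A \<noteq> 1}"
      unfolding unfold by blast
    define R where "R = {A \<in> H. card A \<noteq> 1}"
    define L where "L = (\<lambda>a. {a}) ` (?C - \<Union>R)"
    have R: "\<Union>R \<subseteq> ?C" "disjoint R" "{} \<notin> R" and L: "{A \<in> H. card A = 1} = L"
      using partition_on_split_singletons[OF H(1)] by (simp_all add: R_def L_def)
    have C: "?C \<noteq> {}" using H by auto
    note S = S[unfolded L R_def[symmetric]]
    have finD: "finite (?C - \<Union>R)" using finC by simp
    show "S \<in> {S. sweep_cover T S \<and> card S = n}"
    proof (cases "card L = 0 \<and> card R = n")
      case True
      then have D: "?C - \<Union>R = {}" using finD by (simp add: L_def)
      \<comment> \<open>Without singleton blocks there is no subtree to fill, so the constantly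
        empty family serves as \<open>G\<close>.\<close>
      have "sweep_cover T ((\<Union>a \<in> ?C - \<Union>R. {}) \<union> R)"
        by (rule sweep_cover_compose[OF R C]) (use D in blast)
      then have "sweep_cover T R" by simp
      then show ?thesis using S True by simp
    next
      case False
      then obtain X F where F: "\<And>k. k < card L \<Longrightarrow> F k \<in> sweep_covers (descendant_subtree T (?f L k)) (X ! k)"
        and S: "S = (\<Union>k < card L. F k) \<union> R" "card S = n"
        using S unfolding if_not_P[OF False] by blast
      have bij: "bij_betw (?f L) {..<card L} (?C - \<Union>R)"
        using bij_betw_enumeration_singletons[OF finD] by (simp add: L_def)
      \<comment> \<open>The chosen covers, re-indexed from positions in the enumeration to the nodes
        themselves.\<close>
      define G where "G = F \<circ> inv_into {..<card L} (?f L)"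
      have GF: "G (?f L k) = F k" if "k < card L" for k
        using bij_betw_inv_into_left[OF bij, of k] that by (simp add: G_def)
      have "sweep_cover (descendant_subtree T a) (G a)" if "a \<in> ?C - \<Union>R" for a
      proof -
        have "a \<in> ?f L ` {..<card L}" using that bij_betw_imp_surj_on[OF bij] by simp
        then obtain k where k: "k < card L" "a = ?f L k" by blast
        have "G a \<in> sweep_covers (descendant_subtree T a) (X ! k)"
          unfolding k(2) GF[OF k(1)] by (rule F[OF k(1)])
        then show ?thesis using IH[of a] that by simp
      qed
      then have "sweep_cover T ((\<Union>a \<in> ?C - \<Union>R. G a) \<union> R)"
        by (rule sweep_cover_compose[OF R C])
      moreover have "(\<Union>a \<in> ?C - \<Union>R. G a) = (\<Union>a \<in> ?f L ` {..<card L}. G a)"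
        using bij by (simp only: bij_betw_def)
      then have "(\<Union>a \<in> ?C - \<Union>R. G a) = (\<Union>k < card L. F k)"
        using GF by simp
      ultimately show ?thesis using S by simp
    qed
  next
    fix S assume "S \<in> {S. sweep_cover T S \<and> card S = n}"
    then have S: "sweep_cover T S" "card S = n" by auto
    \<comment> \<open>A cover meeting the linear path has exactly one member, whereas here
      \<open>n \<noteq> 1\<close>.\<close>
    have avoids: "\<forall>w \<in> \<Union>S. \<not> w \<rightarrow>\<^sup>*\<^bsub>T\<^esub> lowest"
      using sweep_cover_meets_stem[OF S(1)] S(2) False by fastforce
    define R where "R = {A \<in> S. A \<subseteq> ?C \<and> card A \<noteq> 1}"
    define G where "G a = {A \<in> S. A \<subseteq> {w. a \<rightarrow>\<^sup>*\<^bsub>T\<^esub> w}}" for a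
    define L where "L = (\<lambda>a. {a}) ` (?C - \<Union>R)"
    note dec = sweep_cover_decompose[OF S(1) avoids, folded R_def G_def]
    have finD: "finite (?C - \<Union>R)" using finC by simp
    have bij: "bij_betw (?f L) {..<card L} (?C - \<Union>R)"
      using bij_betw_enumeration_singletons[OF finD] by (simp add: L_def)
    have cardL: "card L = card (?C - \<Union>R)" by (simp add: L_def card_image)
    have "card ((\<Union>a \<in> ?C - \<Union>R. G a) \<union> R) = (\<Sum>a \<in> ?C - \<Union>R. card (G a)) + card R"
      by (rule card_compose[OF dec(2-4,1,5)])
    then have card: "(\<Sum>a \<in> ?C - \<Union>R. card (G a)) + card R = n"
      using dec(6) S(2) by simp
    have finS: "finite S"
      using S(1) by (intro finite_subset[of S "Pow (verts T)"]) (auto simp: sweep_cover_iff)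
    \<comment> \<open>The root of each subtree has to be covered, so its family is non-empty. This
      makes the parts of the composition positive.\<close>
    have pos: "0 < card (G a)" if a: "a \<in> ?C - \<Union>R" for a
    proof -
      have "a \<in> verts T" using a children_subset_verts by blast
      then have "G a \<noteq> {}"
        using dec(5)[OF a] by (auto simp: sweep_cover_descendant_subtree_iff)
      moreover have "finite (G a)" using finS by (simp add: G_def)
      ultimately show ?thesis by (simp add: card_gt_0_iff)
    qed
    have part: "partition_on ?C (R \<union> L)" "{A \<in> R \<union> L. card A = 1} = L" "{A \<in> R \<union> L. card A \<noteq> 1} = R"
      unfolding L_def using partition_on_add_singletons[OF dec(2-4)] by (auto simp: R_def)
    \<comment> \<open>Each singleton block accounts for at least one subcover, so the partition has
      at most \<open>n\<close> blocks and is among those the algorithm tries.\<close>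
    have "card L \<le> (\<Sum>a \<in> ?C - \<Union>R. card (G a))"
      using sum_bounded_below[of "?C - \<Union>R" 1 "\<lambda>a. card (G a)"] pos cardL by (simp add: Suc_le_eq)
    then have "card (R \<union> L) \<le> n" using card card_Un_le[of R L] by linarith
    moreover have "finite (R \<union> L)" using finC part(1) by (rule finite_elements)
    moreover have "R \<union> L \<noteq> {}" using part(1) dec(1) by (auto simp: partition_on_def)
    ultimately have bounds: "1 \<le> card (R \<union> L)" "card (R \<union> L) \<le> n"
      by (simp_all add: Suc_le_eq card_gt_0_iff)
    have results: "S \<in> ?results L R"
    proof (cases "card L = 0 \<and> card R = n")
      case True
      then have D: "?C - \<Union>R = {}" using finD by (simp add: L_def)
      have "S = R" using dec(6)[unfolded D] by simp
      then show ?thesis using True by simp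
    next
      case False
      \<comment> \<open>The composition is read off from the cover: the sizes of its families in the
        order of the enumeration. By \<open>card\<close>, the subtraction \<open>n - card R\<close>
        is exact.\<close>
      let ?X = "map (\<lambda>k. card (G (?f L k))) [0..<card L]"
      have in_D: "?f L k \<in> ?C - \<Union>R" if "k < card L" for k
        using bij that by (auto simp: bij_betw_def)
      have "sum_list ?X = (\<Sum>k < card L. card (G (?f L k)))"
        by (simp add: lessThan_atLeast0 interv_sum_list_conv_sum_set_nat)
      also have "\<dots> = (\<Sum>a \<in> ?C - \<Union>R. card (G a))"
        by (rule sum.reindex_bij_betw[OF bij])
      finally have "?X \<in> compositions (n - card R) (card L)"
        using card pos in_D by (auto simp: compositions_def)
      moreover have "G (?f L k) \<in> sweep_covers (descendant_subtree T (?f L k)) (?X ! k)"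
        if "k < card L" for k
        using in_D[OF that] IH[of "?f L k"] dec(5)[OF in_D[OF that]] that by simp
      moreover have "(\<Union>a \<in> ?f L ` {..<card L}. G a) = (\<Union>a \<in> ?C - \<Union>R. G a)"
        using bij by (simp only: bij_betw_def)
      then have "S = (\<Union>k < card L. G (?f L k)) \<union> R"
        using dec(6) by simp
      ultimately show ?thesis
        unfolding if_not_P[OF False] using S(2)
        by (intro UN_I[of ?X] CollectI conjI exI[of _ "\<lambda>k. G (?f L k)"] ballI) simp_all
    qed
    show "S \<in> sweep_covers T n"
      unfolding unfold
    proof (rule UN_I)
      show "R \<union> L \<in> {H. partition_on ?C H \<and> 1 \<le> card H \<and> card H \<le> min n (card ?C)}"
        using part(1) bounds card_partition_le[OF part(1) finC] by simp
      show "S \<in> ?results {A \<in> R \<union> L. card A = 1} {A \<in> R \<union> L. card A \<noteq> 1}"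
        unfolding part(2,3) by (rule results)
    qed
  qed
qed

end

text \<open>The subtree at a child omits the root and thus has fewer nodes. The number of subcovers
  is generalised, since recursive calls use the parts of a composition.\<close>

lemma sweep_covers_eq:
  "rooted_tree T r \<Longrightarrow> sweep_covers T n = {S. sweep_cover T S \<and> card S = n}"
proof (induction "card (verts T)" arbitrary: T r n rule: less_induct)
  case less
  interpret rooted_tree T r by (rule less.prems)
  show ?case
  proof (rule sweep_covers_step)
    fix a m assume a: "a \<in> children T lowest"
    show "sweep_covers (descendant_subtree T a) m =
      {S. sweep_cover (descendant_subtree T a) S \<and> card S = m}"
      using less.hyps card_descendant_subtree_less[OF directed_tree a]
        rooted_tree_descendant_subtree a children_subset_verts by blast
  qed
qed

theorem theorem1:
  fixes T :: "('a, 'b) pre_digraph" and n :: nat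
  assumes "directed_tree T"
  shows "sweep_covers T n = {S. sweep_cover T S \<and> card S = n} \<and>
    ((\<nexists>S. sweep_cover T S \<and> card S = n) \<longrightarrow> sweep_covers T n = {})"
proof -
  obtain r where "rooted_tree T r"
    using assms by (auto simp: directed_tree_def rooted_tree_def)
  then have "sweep_covers T n = {S. sweep_cover T S \<and> card S = n}" by (rule sweep_covers_eq)
  then show ?thesis by simp
qed

end
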